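(* Let $m>n$ and let $B=(B_j(t_i))_{1\le i\le m,\,1\le j\le n}$ be the collocation matrix of the NTP basis $B_1,\dots,B_n$ at $t_1<\dots<t_m$. Suppose $\operatorname{rank}(B)=r$ and let $\sigma_1\ge\sigma_2\ge\cdots\ge\sigma_r>0$ be the (nonzero) singular values of $B$. Let $\omega,\gamma,\upsilon$ be real weights satisfying $$0<\omega<2,\qquad \omega-\frac{\omega}{\sigma_1^2\upsilon}<\gamma<\frac{\omega}{2}-\frac{\omega-2}{\sigma_1^2\upsilon},\qquad \upsilon>0 .$$ Then for any initial control point set $\{P_i^0\}_{i=1}^n\subset\mathbb{R}^d$ and any point set $\{\Lambda_i^0\}_{i=1}^m\subset\mathbb{R}^d$, the sequence of curves $C^k(t)$, $k\ge 0$, generated by the MLSPIA method with weights $\omega,\gamma,\upsilon$ converges to a least square fitting curve of $\{Q_i\}_{i=1}^m$.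
   Context: Data: points $Q_1,\dots,Q_m\in\mathbb{R}^d$ and parameters $0=t_1<t_2<\cdots<t_m=1$. $B_1,\dots,B_n$ is a normalized totally positive (NTP) basis of a vector space of real functions on $[0,1]$: it is a basis with $B_i(t)\ge0$ and $\sum_{i=1}^n B_i(t)=1$ for all $t\in[0,1]$, and its collocation matrix at any increasing sequence in $[0,1]$ is totally positive (all minors nonnegative). No full-rank assumption is made on $B$. MLSPIA method with real weights $\omega,\gamma,\upsilon$: given $P_i^0$ ($1\le i\le n$) and $\Lambda_j^0$ ($1\le j\le m$) in $\mathbb{R}^d$, put for $k\ge0$ $$C^k(t)=\sum_{i=1}^n B_i(t)P_i^k,\qquad P_i^{k+1}=P_i^k+\Delta_i^k,\qquad \delta_i^k=\upsilon\sum_{j=1}^m B_i(t_j)\bigl(Q_j-C^k(t_j)\bigr),$$ where $\Delta_i^0=\upsilon\sum_{j=1}^m B_i(t_j)\Lambda_j^0$ and, for $k\ge1$, $\Delta_i^k=(1-\omega)\Delta_i^{k-1}+\gamma\delta_i^k+(\omega-\gamma)\delta_i^{k-1}$, for $i=1,\dots,n$. A least square fitting curve of $\{Q_i\}$ is a curve $\sum_{i=1}^n B_i(t)P_i$ whose control points minimize $\sum_{j=1}^m\|Q_j-\sum_i B_i(t_j)P_i\|^2$; equivalently, with $P=[P_1,\dots,P_n]^T$ and $Q=[Q_1,\dots,Q_m]^T$, $B^TBP=B^TQ$. Convergence of the curves $C^k$ to such a curve means that $P^k=[P_1^k,\dots,P_n^k]^T$ converges as $k\to\infty$ to a solution $P$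 of $B^TBP=B^TQ$. *)

theory Defs
  imports
    "HOL-Analysis.Euclidean_Space"
    "Jordan_Normal_Form.Char_Poly"
    "Jordan_Normal_Form.DL_Rank"
    "Jordan_Normal_Form.DL_Submatrix"
begin

(* Families of points, parameters and functions are indexed by 1,...,n or 1,...,m;
   the entries of the library's matrices are indexed from 0, hence the Suc below. *)

definition collocation_mat :: "nat \<Rightarrow> nat \<Rightarrow> (nat \<Rightarrow> real \<Rightarrow> real) \<Rightarrow> (nat \<Rightarrow> real) \<Rightarrow> real mat" where
  "collocation_mat m n B t = mat m n (\<lambda>(i, j). B (Suc j) (t (Suc i)))"

definition totally_positive :: "real mat \<Rightarrow> bool" where
  "totally_positive A \<longleftrightarrow>
     (\<forall>I J. I \<subseteq> {..<dim_row A} \<longrightarrow> J \<subseteq> {..<dim_col A} \<longrightarrow> card I = card J \<longrightarrow>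
        det (submatrix A I J) \<ge> 0)"

(* The vector space is the span of the B i as functions on [0,1], so being a basis of it
   means being linearly independent on [0,1]. Values outside [0,1] play no role. *)
definition NTP_basis :: "nat \<Rightarrow> (nat \<Rightarrow> real \<Rightarrow> real) \<Rightarrow> bool" where
  "NTP_basis n B \<longleftrightarrow>
     (\<forall>c :: nat \<Rightarrow> real. (\<forall>x\<in>{0..1}. (\<Sum>i=1..n. c i * B i x) = 0) \<longrightarrow> (\<forall>i\<in>{1..n}. c i = 0)) \<and>
     (\<forall>i\<in>{1..n}. \<forall>x\<in>{0..1}. B i x \<ge> 0) \<and>
     (\<forall>x\<in>{0..1}. (\<Sum>i=1..n. B i x) = 1) \<and>
     (\<forall>N (x :: nat \<Rightarrow> real). strict_mono_on {1..N} x \<longrightarrow> x ` {1..N} \<subseteq> {0..1} \<longrightarrow>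
        totally_positive (collocation_mat N n B x))"

(* With multiplicity: the square roots of the eigenvalues of the symmetric matrix A^T A,
   each counted as often as it is a root of the characteristic polynomial. *)
definition singular_values :: "real mat \<Rightarrow> real multiset" where
  "singular_values A = image_mset sqrt (proots (char_poly (transpose_mat A * A)))"

definition curve ::
  "nat \<Rightarrow> (nat \<Rightarrow> real \<Rightarrow> real) \<Rightarrow> (nat \<Rightarrow> 'a::real_vector) \<Rightarrow> real \<Rightarrow> 'a" where
  "curve n B P x = (\<Sum>i=1..n. B i x *\<^sub>R P i)"

definition mlspia_delta ::
  "nat \<Rightarrow> nat \<Rightarrow> (nat \<Rightarrow> real \<Rightarrow> real) \<Rightarrow> (nat \<Rightarrow> real) \<Rightarrow> (nat \<Rightarrow> 'a::real_vector) \<Rightarrow> real \<Rightarrow>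
   (nat \<Rightarrow> 'a) \<Rightarrow> nat \<Rightarrow> 'a" where
  "mlspia_delta m n B t Q \<upsilon> P i =
     \<upsilon> *\<^sub>R (\<Sum>j=1..m. B i (t j) *\<^sub>R (Q j - curve n B P (t j)))"

(* The pair (P^k, Delta^k). *)
primrec mlspia_state ::
  "nat \<Rightarrow> nat \<Rightarrow> (nat \<Rightarrow> real \<Rightarrow> real) \<Rightarrow> (nat \<Rightarrow> real) \<Rightarrow> (nat \<Rightarrow> 'a::real_vector) \<Rightarrow>
   real \<Rightarrow> real \<Rightarrow> real \<Rightarrow> (nat \<Rightarrow> 'a) \<Rightarrow> (nat \<Rightarrow> 'a) \<Rightarrow> nat \<Rightarrow> (nat \<Rightarrow> 'a) \<times> (nat \<Rightarrow> 'a)" where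
  "mlspia_state m n B t Q \<omega> \<gamma> \<upsilon> P0 \<Lambda>0 0 =
     (P0, \<lambda>i. \<upsilon> *\<^sub>R (\<Sum>j=1..m. B i (t j) *\<^sub>R \<Lambda>0 j))"
| "mlspia_state m n B t Q \<omega> \<gamma> \<upsilon> P0 \<Lambda>0 (Suc k) =
     (let (P, D) = mlspia_state m n B t Q \<omega> \<gamma> \<upsilon> P0 \<Lambda>0 k;
          P' = (\<lambda>i. P i + D i);
          \<delta> = mlspia_delta m n B t Q \<upsilon>
      in (P', \<lambda>i. (1 - \<omega>) *\<^sub>R D i + \<gamma> *\<^sub>R \<delta> P' i + (\<omega> - \<gamma>) *\<^sub>R \<delta> P i))"

definition mlspia ::
  "nat \<Rightarrow> nat \<Rightarrow> (nat \<Rightarrow> real \<Rightarrow> real) \<Rightarrow> (nat \<Rightarrow> real) \<Rightarrow> (nat \<Rightarrow> 'a::real_vector) \<Rightarrow>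
   real \<Rightarrow> real \<Rightarrow> real \<Rightarrow> (nat \<Rightarrow> 'a) \<Rightarrow> (nat \<Rightarrow> 'a) \<Rightarrow> nat \<Rightarrow> nat \<Rightarrow> 'a" where
  "mlspia m n B t Q \<omega> \<gamma> \<upsilon> P0 \<Lambda>0 k = fst (mlspia_state m n B t Q \<omega> \<gamma> \<upsilon> P0 \<Lambda>0 k)"

definition least_square_fit ::
  "nat \<Rightarrow> nat \<Rightarrow> (nat \<Rightarrow> real \<Rightarrow> real) \<Rightarrow> (nat \<Rightarrow> real) \<Rightarrow> (nat \<Rightarrow> 'a::real_normed_vector) \<Rightarrow>
   (nat \<Rightarrow> 'a) \<Rightarrow> bool" where
  "least_square_fit m n B t Q P \<longleftrightarrow>
     (\<forall>P'. (\<Sum>j=1..m. (norm (Q j - curve n B P (t j)))\<^sup>2)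
         \<le> (\<Sum>j=1..m. (norm (Q j - curve n B P' (t j)))\<^sup>2))"

(* Convergence of the curves is convergence of their control points. *)
definition converges_to_least_square_fit ::
  "nat \<Rightarrow> nat \<Rightarrow> (nat \<Rightarrow> real \<Rightarrow> real) \<Rightarrow> (nat \<Rightarrow> real) \<Rightarrow> (nat \<Rightarrow> 'a::real_normed_vector) \<Rightarrow>
   (nat \<Rightarrow> nat \<Rightarrow> 'a) \<Rightarrow> bool" where
  "converges_to_least_square_fit m n B t Q Pseq \<longleftrightarrow>
     (\<exists>P. least_square_fit m n B t Q P \<and> (\<forall>i\<in>{1..n}. (\<lambda>k. Pseq k i) \<longlonglongrightarrow> P i))"

end

theory Submission
  imports "HOL-Analysis.Function_Topology" "HOL-Analysis.Topology_Euclidean_Space" Defs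
begin

text \<open>
  Write \<open>A\<close> for the collocation matrix, \<open>d\<^sub>k = P\<^sup>k\<^sup>+\<^sup>1 - P\<^sup>k\<close> for the increments and
  \<open>R\<^sub>k = A P\<^sup>k - Q\<close> for the residuals. The method is the damped second-order recurrence
  \<open>d\<^sub>k\<^sub>+\<^sub>1 = (1 - \<omega>) d\<^sub>k - \<upsilon> A\<^sup>T (\<omega> R\<^sub>k + \<gamma> A d\<^sub>k)\<close>. On an eigenvector of \<open>A\<^sup>T A\<close> with
  eigenvalue \<open>\<lambda> > 0\<close> it becomes a scalar recurrence, whose stability conditions are
  \<open>\<omega> - (\<omega> - \<gamma>) \<upsilon> \<lambda> > 0\<close> and \<open>(4 - 2 \<omega>) + (\<omega> - 2 \<gamma>) \<upsilon> \<lambda> > 0\<close>, besides \<open>\<omega> \<upsilon> > 0\<close>. Both are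
  affine in \<open>\<lambda>\<close> and positive at \<open>\<lambda> = 0\<close>, so they hold on the whole spectrum as soon as they hold
  at \<open>\<lambda> = \<sigma>\<^sub>1\<^sup>2\<close>; this is what the bounds on \<open>\<gamma>\<close> say.

  Instead of diagonalizing \<open>A\<^sup>T A\<close>, the proof uses a Lyapunov function in which these two
  expressions appear as quadratic forms. The energy
  \<open>E\<^sub>k = (4 - 2 \<omega>) |d\<^sub>k|\<^sup>2 + (\<omega> - 2 \<gamma>) \<upsilon> |A d\<^sub>k|\<^sup>2 + \<omega> \<upsilon> |2 R\<^sub>k + A d\<^sub>k|\<^sup>2\<close>
  is nonnegative by the second condition and satisfies
  \<open>E\<^sub>k - E\<^sub>k\<^sub>+\<^sub>1 = 2 (\<omega> |e\<^sub>k|\<^sup>2 - (\<omega> - \<gamma>) \<upsilon> |A e\<^sub>k|\<^sup>2)\<close> with \<open>e\<^sub>k = d\<^sub>k + d\<^sub>k\<^sub>+\<^sub>1\<close>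
  (lemma \<open>energy_Suc\<close>), which by the first condition dominates a multiple of \<open>|e\<^sub>k|\<^sup>2\<close>. Hence
  \<open>e\<^sub>k\<close> tends to \<open>0\<close>. The recurrence expresses \<open>(4 - 2 \<omega>) d\<^sub>k + (\<omega> - 2 \<gamma>) \<upsilon> A\<^sup>T A d\<^sub>k\<close> through
  \<open>e\<^sub>k\<close> and \<open>e\<^sub>k\<^sub>+\<^sub>1\<close> (lemma \<open>mass_D_eq\<close>), so \<open>d\<^sub>k\<close> tends to \<open>0\<close>, and then so does the gradient
  \<open>A\<^sup>T R\<^sub>k\<close>.

  When \<open>A\<close> is rank deficient, a vanishing gradient alone does not make \<open>P\<^sup>k\<close> converge. But all
  increments lie in the range of \<open>A\<^sup>T\<close>, because \<open>d\<^sub>0 = \<upsilon> A\<^sup>T \<Lambda>\<^sup>0\<close> does, and \<open>A\<^sup>T A\<close> is bounded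
  below on the orthogonal complement of the kernel of \<open>A\<close> (lemma \<open>coercive_on_ker_orth\<close>). So
  \<open>P\<^sup>k\<close> is a Cauchy sequence, and its limit solves the normal equations.

  The only spectral fact used is that the smallest \<open>L\<close> with \<open>|A x|\<^sup>2 \<le> L |x|\<^sup>2\<close> for all \<open>x\<close> is an
  eigenvalue of \<open>A\<^sup>T A\<close> (lemma \<open>ex_max_eigenvalue_real\<close>): the quadratic form attains its maximum
  on the unit sphere.
\<close>

section \<open>Inner products of finite families\<close>

text \<open>
  Control point families are functions on an arbitrary index type restricted to a finite index
  set, since the numbers of points and of functions are variables and cannot be the dimension of
  a type.
\<close>

definition ip :: "'i set \<Rightarrow> ('i \<Rightarrow> 'a::real_inner) \<Rightarrow> ('i \<Rightarrow> 'a) \<Rightarrow> real" where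
  "ip S x y = (\<Sum>i\<in>S. inner (x i) (y i))"

lemma ip_add_left: "ip S (\<lambda>i. x i + y i) z = ip S x z + ip S y z"
  by (simp add: ip_def inner_add_left sum.distrib)

lemma ip_add_right: "ip S z (\<lambda>i. x i + y i) = ip S z x + ip S z y"
  by (simp add: ip_def inner_add_right sum.distrib)

lemma ip_diff_left: "ip S (\<lambda>i. x i - y i) z = ip S x z - ip S y z"
  by (simp add: ip_def inner_diff_left sum_subtractf)

lemma ip_diff_right: "ip S z (\<lambda>i. x i - y i) = ip S z x - ip S z y"
  by (simp add: ip_def inner_diff_right sum_subtractf)

lemma ip_scaleR_left: "ip S (\<lambda>i. c *\<^sub>R x i) z = c * ip S x z"
  by (simp add: ip_def sum_distrib_left)

lemma ip_scaleR_right: "ip S z (\<lambda>i. c *\<^sub>R x i) = c * ip S z x"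
  by (simp add: ip_def sum_distrib_left)

lemmas ip_bilinear =
  ip_add_left ip_add_right ip_diff_left ip_diff_right ip_scaleR_left ip_scaleR_right

lemma ip_commute: "ip S x y = ip S y x"
  by (simp add: ip_def inner_commute)

lemma ip_self_nonneg: "ip S x x \<ge> 0"
  by (simp add: ip_def sum_nonneg)

lemma ip_self_eq_0_iff: "finite S \<Longrightarrow> ip S x x = 0 \<longleftrightarrow> (\<forall>i\<in>S. x i = 0)"
  by (simp add: ip_def sum_nonneg_eq_0_iff)

lemma norm_le_ip_self: "finite S \<Longrightarrow> i \<in> S \<Longrightarrow> (norm (x i))\<^sup>2 \<le> ip S x x"
  unfolding ip_def power2_norm_eq_inner by (rule member_le_sum) auto

lemma two_ip_le:
  assumes "c > 0"
  shows "2 * ip S x y \<le> c * ip S x x + ip S y y / c"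
proof -
  have "0 \<le> ip S (\<lambda>i. c *\<^sub>R x i - y i) (\<lambda>i. c *\<^sub>R x i - y i) / c"
    using assms by (intro divide_nonneg_pos ip_self_nonneg)
  also have "\<dots> = c * ip S x x - 2 * ip S x y + ip S y y / c"
    using assms by (simp add: ip_bilinear ip_commute[of S y x] field_simps)
  finally show ?thesis by simp
qed

text \<open>
  Coordinates with respect to an orthonormal basis reduce quadratic inequalities for families of
  points to the case of families of real numbers.
\<close>

lemma ip_euclidean:
  fixes x y :: "'i \<Rightarrow> 'a::euclidean_space"
  shows "ip S x y = (\<Sum>b\<in>Basis. ip S (\<lambda>i. inner (x i) b) (\<lambda>i. inner (y i) b))"
  unfolding ip_def inner_real_def
  by (subst sum.swap) (intro sum.cong refl euclidean_inner)

lemma tendsto_ip_self_0_iff: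
  fixes x :: "nat \<Rightarrow> 'i \<Rightarrow> 'a::real_inner"
  assumes "finite S"
  shows "((\<lambda>k. ip S (x k) (x k)) \<longlonglongrightarrow> 0) \<longleftrightarrow> (\<forall>i\<in>S. (\<lambda>k. x k i) \<longlonglongrightarrow> 0)"
proof
  assume lim: "(\<lambda>k. ip S (x k) (x k)) \<longlonglongrightarrow> 0"
  show "\<forall>i\<in>S. (\<lambda>k. x k i) \<longlonglongrightarrow> 0"
  proof
    fix i assume i: "i \<in> S"
    have "(\<lambda>k. (norm (x k i))\<^sup>2) \<longlonglongrightarrow> 0"
      by (rule tendsto_sandwich[OF _ _ tendsto_const lim])
        (auto intro!: always_eventually norm_le_ip_self assms i)
    hence "(\<lambda>k. sqrt ((norm (x k i))\<^sup>2)) \<longlonglongrightarrow> sqrt 0"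
      by (rule tendsto_real_sqrt)
    thus "(\<lambda>k. x k i) \<longlonglongrightarrow> 0"
      by (simp add: tendsto_norm_zero_iff)
  qed
next
  assume lim: "\<forall>i\<in>S. (\<lambda>k. x k i) \<longlonglongrightarrow> 0"
  have "(\<lambda>k. \<Sum>i\<in>S. inner (x k i) (x k i)) \<longlonglongrightarrow> (\<Sum>i\<in>S. inner (0::'a) 0)"
    using lim by (intro tendsto_sum tendsto_inner) auto
  thus "(\<lambda>k. ip S (x k) (x k)) \<longlonglongrightarrow> 0"
    by (simp add: ip_def)
qed

section \<open>Quadratic forms on the unit sphere\<close>

definition unit_sphere :: "'i set \<Rightarrow> ('i \<Rightarrow> real) set" where
  "unit_sphere I = {x. (\<forall>i. i \<notin> I \<longrightarrow> x i = 0) \<and> ip I x x = 1}"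

lemma continuous_on_coordinate: "continuous_on A (\<lambda>x::'i \<Rightarrow> real. x i)"
  by (rule continuous_on_subset[OF continuous_on_product_coordinates]) simp

text \<open>
  In the product topology the sphere is a closed subset of a product of compact intervals.
  The coordinates outside the index set are fixed at \<open>0\<close>, for otherwise the set would be
  unbounded in them.
\<close>

lemma compact_unit_sphere:
  fixes I :: "'i set"
  assumes "finite I"
  shows "compact (unit_sphere I)"
proof -
  let ?box = "PiE UNIV (\<lambda>i. if i \<in> I then {-1..1} else {0::real})"
  have box: "compact ?box"
    using compactin_PiE[of "\<lambda>_::'i. euclidean :: real topology" UNIV
        "\<lambda>i. if i \<in> I then {-1..1} else {0::real}"]
    by (auto simp: euclidean_product_topology)
  have closed: "closed {x::'i \<Rightarrow> real. ip I x x = 1}"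
    unfolding ip_def inner_real_def
    by (intro closed_Collect_eq continuous_on_sum continuous_on_mult continuous_on_const
        continuous_on_coordinate)
  have sub: "unit_sphere I \<subseteq> ?box"
  proof
    fix x assume x: "x \<in> unit_sphere I"
    have "x i \<in> {-1..1}" if "i \<in> I" for i
    proof -
      have "(norm (x i))\<^sup>2 \<le> 1\<^sup>2"
        using norm_le_ip_self[OF assms that, of x] x by (simp add: unit_sphere_def)
      hence "norm (x i) \<le> 1" by (rule power2_le_imp_le) simp
      thus ?thesis by (simp add: abs_le_iff)
    qed
    thus "x \<in> ?box" using x by (auto simp: unit_sphere_def)
  qed
  have "unit_sphere I = ?box \<inter> {x. ip I x x = 1}"
    using sub by (auto simp: unit_sphere_def PiE_iff split: if_splits)
  thus ?thesis using compact_Int_closed[OF box closed] by simp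
qed

lemma obtain_normalized:
  assumes "finite I" "ip I x x > 0"
  obtains y where "y \<in> unit_sphere I"
    "\<And>i. i \<in> I \<Longrightarrow> x i = sqrt (ip I x x) *\<^sub>R y i"
proof
  let ?y = "\<lambda>i. if i \<in> I then x i / sqrt (ip I x x) else 0"
  have "ip I ?y ?y = ip I x x / (sqrt (ip I x x))\<^sup>2"
    unfolding ip_def by (simp add: sum_divide_distrib power2_eq_square)
  also have "\<dots> = 1" using assms by simp
  finally show "?y \<in> unit_sphere I" by (simp add: unit_sphere_def)
qed (use assms in auto)

section \<open>Real matrices acting on families\<close>

locale finite_real_matrix =
  fixes I :: "'i set" and J :: "'j set" and a :: "'j \<Rightarrow> 'i \<Rightarrow> real"
  assumes finite_I: "finite I" and finite_J: "finite J"
begin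

definition app :: "('i \<Rightarrow> 'a::real_vector) \<Rightarrow> 'j \<Rightarrow> 'a" where
  "app x j = (\<Sum>i\<in>I. a j i *\<^sub>R x i)"

text \<open>
  The transposed matrix, hence the adjoint for the inner products \<open>ip I\<close> and \<open>ip J\<close>.
\<close>

definition adj :: "('j \<Rightarrow> 'a::real_vector) \<Rightarrow> 'i \<Rightarrow> 'a" where
  "adj y i = (\<Sum>j\<in>J. a j i *\<^sub>R y j)"

lemma app_add: "app (\<lambda>i. x i + y i) = (\<lambda>j. app x j + app y j)"
  by (auto simp: app_def scaleR_add_right sum.distrib)

lemma app_diff: "app (\<lambda>i. x i - y i) = (\<lambda>j. app x j - app y j)"
  by (auto simp: app_def scaleR_diff_right sum_subtractf)

lemma app_scaleR: "app (\<lambda>i. c *\<^sub>R x i) = (\<lambda>j. c *\<^sub>R app x j)"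
  by (auto simp: app_def scaleR_sum_right mult.commute)

lemma adj_add: "adj (\<lambda>i. x i + y i) = (\<lambda>j. adj x j + adj y j)"
  by (auto simp: adj_def scaleR_add_right sum.distrib)

lemma adj_diff: "adj (\<lambda>i. x i - y i) = (\<lambda>j. adj x j - adj y j)"
  by (auto simp: adj_def scaleR_diff_right sum_subtractf)

lemma adj_scaleR: "adj (\<lambda>i. c *\<^sub>R x i) = (\<lambda>j. c *\<^sub>R adj x j)"
  by (auto simp: adj_def scaleR_sum_right mult.commute)

lemmas app_linear = app_add app_diff app_scaleR
lemmas adj_linear = adj_add adj_diff adj_scaleR

lemma app_cong: "(\<And>i. i \<in> I \<Longrightarrow> x i = y i) \<Longrightarrow> app x = app y"
  by (auto simp: app_def)

lemma app_inner: "app (\<lambda>i. inner (x i) b) j = inner (app x j) b"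
  by (simp add: app_def inner_sum_left)

lemma adj_inner: "adj (\<lambda>i. inner (x i) b) j = inner (adj x j) b"
  by (simp add: adj_def inner_sum_left)

lemma ip_adj: "ip I x (adj y) = ip J (app x) y"
  unfolding ip_def app_def adj_def inner_sum_right inner_sum_left
  by (subst sum.swap) simp

lemma tendsto_app:
  assumes "\<And>i. i \<in> I \<Longrightarrow> ((\<lambda>k. x k i) \<longlongrightarrow> l i) F"
  shows "((\<lambda>k. app (x k) j) \<longlongrightarrow> (app l j :: 'a::real_normed_vector)) F"
  unfolding app_def by (intro tendsto_intros assms)

lemma tendsto_adj:
  assumes "\<And>j. j \<in> J \<Longrightarrow> ((\<lambda>k. y k j) \<longlongrightarrow> l j) F"
  shows "((\<lambda>k. adj (y k) i) \<longlongrightarrow> (adj l i :: 'a::real_normed_vector)) F"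
  unfolding adj_def by (intro tendsto_intros assms)

lemma continuous_on_app: "continuous_on A (\<lambda>x::'i \<Rightarrow> real. app x j)"
  unfolding app_def by (intro continuous_intros continuous_on_coordinate)

lemma continuous_on_ip_app: "continuous_on A (\<lambda>x::'i \<Rightarrow> real. ip J (app x) (app x))"
  unfolding ip_def inner_real_def
  by (intro continuous_on_sum continuous_on_mult continuous_on_app)

text \<open>
  A maximizer \<open>x0\<close> of the quadratic form \<open>x \<mapsto> |A x|\<^sup>2\<close> on the unit sphere, with maximum \<open>L\<close>, is a
  zero of the positive semidefinite form \<open>L |x|\<^sup>2 - |A x|\<^sup>2\<close>. Such a form vanishes at \<open>x0\<close> only if
  its polar form does so against every direction, which is the eigenvalue equation.
\<close>

lemma ex_max_eigenvalue_real:
  assumes "I \<noteq> {}"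
  shows "\<exists>L\<ge>0. \<exists>x0. x0 \<in> unit_sphere I \<and> (\<forall>i\<in>I. adj (app x0) i = L * x0 i) \<and>
    (\<forall>x::'i \<Rightarrow> real. ip J (app x) (app x) \<le> L * ip I x x)"
proof -
  let ?q = "\<lambda>x::'i \<Rightarrow> real. ip J (app x) (app x)"
  obtain i0 where i0: "i0 \<in> I" using assms by auto
  have "(\<lambda>i. if i = i0 then 1 else 0) \<in> unit_sphere I"
    using i0 finite_I by (auto simp: unit_sphere_def ip_def if_distrib[of "\<lambda>x. x * _"] cong: if_cong)
  hence "unit_sphere I \<noteq> {}" by auto
  from continuous_attains_sup[OF compact_unit_sphere[OF finite_I] this continuous_on_ip_app]
  obtain x0 where x0: "x0 \<in> unit_sphere I" and max: "\<And>y. y \<in> unit_sphere I \<Longrightarrow> ?q y \<le> ?q x0"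
    by auto
  define L where "L = ?q x0"
  have bound: "?q x \<le> L * ip I x x" for x
  proof (cases "ip I x x = 0")
    case True
    hence "app x = (\<lambda>j. 0)"
      using ip_self_eq_0_iff[OF finite_I, of x] by (auto simp: app_def fun_eq_iff)
    thus ?thesis using True by (simp add: ip_def)
  next
    case False
    hence pos: "ip I x x > 0" using ip_self_nonneg[of I x] by simp
    then obtain y where y: "y \<in> unit_sphere I"
      and xy: "\<And>i. i \<in> I \<Longrightarrow> x i = sqrt (ip I x x) *\<^sub>R y i"
      using obtain_normalized[OF finite_I] by metis
    have "app x = (\<lambda>j. sqrt (ip I x x) *\<^sub>R app y j)"
      using app_cong[of x "\<lambda>i. sqrt (ip I x x) *\<^sub>R y i"] xy by (simp only: app_scaleR)
    hence "?q x = ip I x x * ?q y"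
      using pos by (simp only: ip_bilinear) simp
    thus ?thesis using max[OF y] pos by (simp add: L_def mult.commute)
  qed
  have "adj (app x0) i = L * x0 i" if i: "i \<in> I" for i
  proof -
    define y where "y = (\<lambda>j. if j = i then 1 else 0 :: real)"
    have eval: "ip I y z = z i" for z
      using i finite_I by (simp add: ip_def y_def if_distrib[of "\<lambda>x. x * _"] cong: if_cong)
    define b where "b = L * ip I y x0 - ip J (app y) (app x0)"
    define c where "c = L * ip I y y - ?q y"
    have quad: "0 \<le> 2 * s * b + s\<^sup>2 * c" for s
    proof -
      have "?q (\<lambda>j. x0 j + s *\<^sub>R y j) \<le> L * ip I (\<lambda>j. x0 j + s *\<^sub>R y j) (\<lambda>j. x0 j + s *\<^sub>R y j)"
        by (rule bound)
      moreover have "ip I x0 x0 = 1" using x0 by (simp add: unit_sphere_def)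
      moreover have "?q x0 = L" by (simp add: L_def)
      ultimately show ?thesis
        unfolding b_def c_def app_linear ip_bilinear
        by (simp add: ip_commute[of I x0 y] ip_commute[of J "app x0" "app y"]
            algebra_simps power2_eq_square)
    qed
    have "c \<ge> 0" using bound[of y] by (simp add: c_def)
    have "b = 0"
    proof (rule ccontr)
      assume "b \<noteq> 0"
      \<comment> \<open>close to the minimizer \<open>- b / c\<close> of the quadratic, but defined for \<open>c = 0\<close> too\<close>
      define s where "s = - b / (c + 1)"
      have b: "b = - s * (c + 1)" and s: "s \<noteq> 0"
        using \<open>c \<ge> 0\<close> \<open>b \<noteq> 0\<close> by (auto simp: s_def)
      have "0 \<le> 2 * s * b + s\<^sup>2 * c" by (rule quad)
      also have "\<dots> = - (s\<^sup>2 * (c + 2))"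
        unfolding b by (simp add: algebra_simps power2_eq_square)
      also have "\<dots> < 0" using \<open>c \<ge> 0\<close> s by simp
      finally show False by simp
    qed
    thus ?thesis
      unfolding b_def ip_adj[symmetric] eval by simp
  qed
  moreover have "L \<ge> 0" unfolding L_def by (rule ip_self_nonneg)
  ultimately show ?thesis using x0 bound by blast
qed

text \<open>
  Orthogonality to the kernel, tested against real vectors only: for a family of points this says
  that every coordinate family is orthogonal to the kernel.
\<close>

definition ker_orth :: "('i \<Rightarrow> 'a::real_vector) \<Rightarrow> bool" where
  "ker_orth x \<longleftrightarrow> (\<forall>y::'i \<Rightarrow> real. (\<forall>j\<in>J. app y j = 0) \<longrightarrow> (\<Sum>i\<in>I. y i *\<^sub>R x i) = 0)"

lemma ker_orth_add: "ker_orth x \<Longrightarrow> ker_orth y \<Longrightarrow> ker_orth (\<lambda>i. x i + y i)"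
  by (simp add: ker_orth_def scaleR_add_right sum.distrib)

lemma ker_orth_diff: "ker_orth x \<Longrightarrow> ker_orth y \<Longrightarrow> ker_orth (\<lambda>i. x i - y i)"
  by (simp add: ker_orth_def scaleR_diff_right sum_subtractf)

lemma ker_orth_scaleR: "ker_orth x \<Longrightarrow> ker_orth (\<lambda>i. c *\<^sub>R x i)"
proof -
  have "(\<Sum>i\<in>I. y i *\<^sub>R c *\<^sub>R x i) = c *\<^sub>R (\<Sum>i\<in>I. y i *\<^sub>R x i)" for y :: "'i \<Rightarrow> real"
    by (simp add: scaleR_sum_right mult.commute)
  thus "ker_orth x \<Longrightarrow> ker_orth (\<lambda>i. c *\<^sub>R x i)"
    by (auto simp: ker_orth_def)
qed

lemma ker_orth_adj: "ker_orth (adj z)"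
  unfolding ker_orth_def
proof (intro allI impI)
  fix y :: "'i \<Rightarrow> real" assume y: "\<forall>j\<in>J. app y j = 0"
  have "(\<Sum>i\<in>I. y i *\<^sub>R adj z i) = (\<Sum>i\<in>I. \<Sum>j\<in>J. (a j i * y i) *\<^sub>R z j)"
    by (simp add: adj_def scaleR_sum_right mult.commute)
  also have "\<dots> = (\<Sum>j\<in>J. \<Sum>i\<in>I. (a j i * y i) *\<^sub>R z j)" by (rule sum.swap)
  also have "\<dots> = (\<Sum>j\<in>J. app y j *\<^sub>R z j)" by (simp add: app_def scaleR_sum_left)
  also have "\<dots> = 0" using y by simp
  finally show "(\<Sum>i\<in>I. y i *\<^sub>R adj z i) = 0" .
qed

lemma ker_orth_inner:
  assumes "ker_orth x"
  shows "ker_orth (\<lambda>i. inner (x i) b)"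
  unfolding ker_orth_def
proof (intro allI impI)
  fix y :: "'i \<Rightarrow> real" assume "\<forall>j\<in>J. app y j = 0"
  hence "(\<Sum>i\<in>I. y i *\<^sub>R x i) = 0" using assms by (simp add: ker_orth_def)
  hence "inner (\<Sum>i\<in>I. y i *\<^sub>R x i) b = 0" by simp
  thus "(\<Sum>i\<in>I. y i *\<^sub>R inner (x i) b) = 0" by (simp add: inner_sum_left)
qed

text \<open>
  The vectors orthogonal to the kernel form a closed set, so the form \<open>|A\<^sup>T A x|\<^sup>2\<close> has a minimum
  on its intersection with the unit sphere. The minimum is positive, since \<open>A\<^sup>T A x = 0\<close> forces
  \<open>|A x|\<^sup>2 = \<langle>x, A\<^sup>T A x\<rangle> = 0\<close> and thus puts \<open>x\<close> into the kernel as well as its complement.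
\<close>

lemma coercive_on_ker_orth_real:
  "\<exists>c>0. \<forall>x::'i \<Rightarrow> real. ker_orth x \<longrightarrow> c * ip I x x \<le> ip I (adj (app x)) (adj (app x))"
proof -
  let ?q = "\<lambda>x::'i \<Rightarrow> real. ip I (adj (app x)) (adj (app x))"
  let ?K = "unit_sphere I \<inter> {x. ker_orth x}"
  have "closed {x::'i \<Rightarrow> real. ker_orth x}"
    unfolding ker_orth_def
    by (intro closed_Collect_all closed_Collect_imp closed_Collect_eq open_Collect_const
        continuous_intros continuous_on_coordinate)
  hence K: "compact ?K" by (intro compact_Int_closed compact_unit_sphere finite_I)
  have cont: "continuous_on ?K ?q"
    unfolding ip_def adj_def inner_real_def
    by (intro continuous_on_sum continuous_on_mult continuous_on_scaleR continuous_on_const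
        continuous_on_app)
  have pos: "?q x > 0" if x: "x \<in> ?K" for x
  proof (rule ccontr)
    assume "\<not> ?q x > 0"
    hence "?q x = 0" using ip_self_nonneg[of I "adj (app x)"] by linarith
    hence "\<forall>i\<in>I. adj (app x) i = 0" by (simp add: ip_self_eq_0_iff[OF finite_I])
    hence "ip I x (adj (app x)) = 0" by (simp add: ip_def)
    hence "\<forall>j\<in>J. app x j = 0" by (simp add: ip_adj ip_self_eq_0_iff[OF finite_J])
    hence "ip I x x = 0" using x by (simp add: ker_orth_def ip_def)
    thus False using x by (simp add: unit_sphere_def)
  qed
  obtain c where c: "c > 0" "\<And>x. x \<in> ?K \<Longrightarrow> c \<le> ?q x"
  proof (cases "?K = {}")
    case True
    then show ?thesis using that[of 1] by simp
  next
    case False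
    from continuous_attains_inf[OF K False cont] show ?thesis using pos that by metis
  qed
  have "c * ip I x x \<le> ?q x" if orth: "ker_orth x" for x
  proof (cases "ip I x x = 0")
    case True
    thus ?thesis by (simp add: ip_self_nonneg)
  next
    case False
    hence pos: "ip I x x > 0" using ip_self_nonneg[of I x] by simp
    then obtain y where y: "y \<in> unit_sphere I"
      and xy: "\<And>i. i \<in> I \<Longrightarrow> x i = sqrt (ip I x x) *\<^sub>R y i"
      using obtain_normalized[OF finite_I] by metis
    have "app x = (\<lambda>j. sqrt (ip I x x) *\<^sub>R app y j)"
      using app_cong[of x "\<lambda>i. sqrt (ip I x x) *\<^sub>R y i"] xy by (simp only: app_scaleR)
    hence eq: "?q x = ip I x x * ?q y"
      using pos by (simp only: ip_bilinear adj_scaleR) simp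
    have "ker_orth y"
      unfolding ker_orth_def
    proof (intro allI impI)
      fix z :: "'i \<Rightarrow> real" assume "\<forall>j\<in>J. app z j = 0"
      hence "0 = (\<Sum>i\<in>I. z i *\<^sub>R x i)" using orth by (simp add: ker_orth_def)
      also have "\<dots> = (\<Sum>i\<in>I. sqrt (ip I x x) * (z i * y i))"
        using xy by (intro sum.cong) auto
      also have "\<dots> = sqrt (ip I x x) * (\<Sum>i\<in>I. z i * y i)"
        by (simp add: sum_distrib_left)
      finally show "(\<Sum>i\<in>I. z i *\<^sub>R y i) = 0" using pos by simp
    qed
    thus ?thesis using c(2)[of y] y pos by (simp add: eq mult.commute)
  qed
  with c(1) show ?thesis by blast
qed

lemma coercive_on_ker_orth:
  "\<exists>c>0. \<forall>x::'i \<Rightarrow> 'a::euclidean_space. ker_orth x \<longrightarrow>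
     c * ip I x x \<le> ip I (adj (app x)) (adj (app x))"
proof -
  obtain c where c: "c > 0" and le: "\<And>x::'i \<Rightarrow> real. ker_orth x \<Longrightarrow>
      c * ip I x x \<le> ip I (adj (app x)) (adj (app x))"
    using coercive_on_ker_orth_real by auto
  have "c * ip I x x \<le> ip I (adj (app x)) (adj (app x))" if "ker_orth x" for x :: "'i \<Rightarrow> 'a"
    unfolding ip_euclidean[of I x x] ip_euclidean[of I "adj (app x)"]
      adj_inner[symmetric] app_inner[symmetric] sum_distrib_left
    by (intro sum_mono le ker_orth_inner that)
  with c show ?thesis by blast
qed

lemma rayleigh_bound_euclidean:
  fixes x :: "'i \<Rightarrow> 'a::euclidean_space"
  assumes "\<And>x::'i \<Rightarrow> real. ip J (app x) (app x) \<le> L * ip I x x"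
  shows "ip J (app x) (app x) \<le> L * ip I x x"
  unfolding ip_euclidean[of I x x] ip_euclidean[of J "app x"] app_inner[symmetric] sum_distrib_left
  by (intro sum_mono assms)

end

section \<open>The iteration\<close>

text \<open>
  The energy balance, with every inner product replaced by a real variable. It is linear in
  these, and its hypothesis is the recurrence paired with \<open>d + d'\<close>; here \<open>u = A d\<close>, \<open>v = A d'\<close>, and
  juxtaposed letters stand for an inner product.
\<close>

lemma scalar_energy_identity:
  fixes \<omega> \<gamma> \<upsilon> dd dd' d'd' uu uv vv uR vR RR :: real
  assumes "dd' + d'd' = (1 - \<omega>) * (dd + dd') - \<upsilon> * (\<omega> * (uR + vR) + \<gamma> * (uu + uv))"
  shows "(4 - 2*\<omega>) * d'd' + (\<omega> - 2*\<gamma>) * \<upsilon> * vv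
      + \<omega> * \<upsilon> * (4*RR + 4*uu + vv + 8*uR + 4 * vR + 4*uv)
    = (4 - 2*\<omega>) * dd + (\<omega> - 2*\<gamma>) * \<upsilon> * uu + \<omega> * \<upsilon> * (4*RR + uu + 4*uR)
      - 2 * (\<omega> * (dd + 2*dd' + d'd') - (\<omega> - \<gamma>) * \<upsilon> * (uu + 2*uv + vv))"
proof -
  \<comment> \<open>the balance is the recurrence times \<open>4\<close>, up to linear rearrangement\<close>
  have "4 * (dd' + d'd') = 4 * ((1 - \<omega>) * (dd + dd') - \<upsilon> * (\<omega> * (uR + vR) + \<gamma> * (uu + uv)))"
    using assms by simp
  thus ?thesis by (simp add: algebra_simps)
qed

text \<open>
  The iteration for an arbitrary matrix and with the weight conditions in the form in which the
  energy argument uses them: \<open>coercive_dissipation\<close> makes the loss of energy control \<open>e\<^sub>k\<close>, and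
  \<open>coercive_mass\<close> makes the energy nonnegative. The family \<open>D k\<close> is the increment \<open>d\<^sub>k\<close>.
\<close>

locale mlspia_iteration = finite_real_matrix I J a
  for I :: "'i set" and J :: "'j set" and a :: "'j \<Rightarrow> 'i \<Rightarrow> real" +
  fixes Q :: "'j \<Rightarrow> 'a::euclidean_space"
    and P D :: "nat \<Rightarrow> 'i \<Rightarrow> 'a"
    and \<omega> \<gamma> \<upsilon> c :: real
  assumes step_P: "P (Suc k) = (\<lambda>i. P k i + D k i)"
    and step_D: "D (Suc k) = (\<lambda>i. (1 - \<omega>) *\<^sub>R D k i
      - \<upsilon> *\<^sub>R adj (\<lambda>j. \<omega> *\<^sub>R (app (P k) j - Q j) + \<gamma> *\<^sub>R app (D k) j) i)"
    and orth_D0: "ker_orth (D 0)"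
    and weights_pos: "\<omega> > 0" "\<upsilon> > 0"
    and c_pos: "c > 0"
    and coercive_dissipation:
      "c * ip I x x \<le> \<omega> * ip I x x - (\<omega> - \<gamma>) * \<upsilon> * ip J (app x) (app (x :: 'i \<Rightarrow> 'a))"
    and coercive_mass:
      "c * ip I x x \<le> (4 - 2*\<omega>) * ip I x x + (\<omega> - 2*\<gamma>) * \<upsilon> * ip J (app x) (app (x :: 'i \<Rightarrow> 'a))"
begin

definition resid :: "nat \<Rightarrow> 'j \<Rightarrow> 'a" where
  "resid k j = app (P k) j - Q j"

definition two_step :: "nat \<Rightarrow> 'i \<Rightarrow> 'a" where
  "two_step k i = D k i + D (Suc k) i"

text \<open>
  Up to an additive constant, the last summand is \<open>4 \<omega> \<upsilon>\<close> times \<open>\<langle>p, A\<^sup>T A p'\<rangle> + |A d|\<^sup>2 / 4\<close> for the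
  errors \<open>p\<close>, \<open>p'\<close> of two successive iterates: \<open>2 R\<^sub>k + A d\<^sub>k\<close> is the sum of two successive
  residuals. Residuals are used rather than errors, so that no solution of the normal equations
  has to be known in advance.
\<close>

definition energy :: "nat \<Rightarrow> real" where
  "energy k = (4 - 2*\<omega>) * ip I (D k) (D k) + (\<omega> - 2*\<gamma>) * \<upsilon> * ip J (app (D k)) (app (D k))
     + \<omega> * \<upsilon> * ip J (\<lambda>j. 2 *\<^sub>R resid k j + app (D k) j) (\<lambda>j. 2 *\<^sub>R resid k j + app (D k) j)"

lemma resid_Suc: "resid (Suc k) = (\<lambda>j. resid k j + app (D k) j)"
  by (auto simp: resid_def step_P app_add)

lemma D_Suc: "D (Suc k) = (\<lambda>i. (1 - \<omega>) *\<^sub>R D k i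
      - \<upsilon> *\<^sub>R (\<omega> *\<^sub>R adj (resid k) i + \<gamma> *\<^sub>R adj (app (D k)) i))"
  unfolding step_D resid_def[symmetric] adj_linear ..

lemma energy_nonneg: "energy k \<ge> 0"
proof -
  have "0 \<le> c * ip I (D k) (D k)" using c_pos by (simp add: ip_self_nonneg)
  also note coercive_mass[of "D k"]
  finally show ?thesis
    unfolding energy_def using weights_pos by (simp add: ip_self_nonneg)
qed

text \<open>
  All changes from \<open>k\<close> to \<open>k + 1\<close> are multiples of pairings with \<open>e\<^sub>k = d\<^sub>k + d\<^sub>k\<^sub>+\<^sub>1\<close>: the squares
  of \<open>d\<close> change by \<open>\<langle>e\<^sub>k, d\<^sub>k\<^sub>+\<^sub>1 - d\<^sub>k\<rangle>\<close>, and the sum of two successive residuals changes by \<open>A e\<^sub>k\<close>.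
  So one pairing of the recurrence with \<open>e\<^sub>k\<close> settles the balance.
\<close>

lemma energy_Suc:
  "energy (Suc k) = energy k - 2 * (\<omega> * ip I (two_step k) (two_step k)
     - (\<omega> - \<gamma>) * \<upsilon> * ip J (app (two_step k)) (app (two_step k)))"
proof -
  define d d' where "d = D k" and "d' = D (Suc k)"
  define u v R where "u = app d" and "v = app d'" and "R = resid k"
  have d': "d' = (\<lambda>i. (1 - \<omega>) *\<^sub>R d i - \<upsilon> *\<^sub>R (\<omega> *\<^sub>R adj R i + \<gamma> *\<^sub>R adj u i))"
    unfolding d'_def d_def R_def u_def by (rule D_Suc)
  have e: "two_step k = (\<lambda>i. d i + d' i)"
    by (auto simp: two_step_def d_def d'_def)
  have "ip I (\<lambda>i. d i + d' i) d' = ip I (\<lambda>i. d i + d' i)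
      (\<lambda>i. (1 - \<omega>) *\<^sub>R d i - \<upsilon> *\<^sub>R (\<omega> *\<^sub>R adj R i + \<gamma> *\<^sub>R adj u i))"
    using d' by simp
  hence id: "ip I d d' + ip I d' d' = (1 - \<omega>) * (ip I d d + ip I d d')
      - \<upsilon> * (\<omega> * (ip J u R + ip J v R) + \<gamma> * (ip J u u + ip J u v))"
    unfolding ip_bilinear ip_adj u_def[symmetric] v_def[symmetric]
      ip_commute[of I d' d] ip_commute[of J v u]
    by (simp add: algebra_simps)
  show ?thesis
    using scalar_energy_identity[OF id, of "ip J v v" "ip J R R"]
    unfolding energy_def e resid_Suc app_add d_def[symmetric] d'_def[symmetric]
      u_def[symmetric] v_def[symmetric] R_def[symmetric] ip_bilinear
    by (simp add: ip_commute[of I d' d] ip_commute[of J v u] ip_commute[of J R u]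
        ip_commute[of J R v] algebra_simps)
qed

lemma two_step_tendsto_0: "i \<in> I \<Longrightarrow> (\<lambda>k. two_step k i) \<longlonglongrightarrow> 0"
proof -
  have drop: "2 * c * ip I (two_step k) (two_step k) \<le> energy k - energy (Suc k)" for k
    using coercive_dissipation[of "two_step k"] by (simp add: energy_Suc)
  have "energy (Suc k) \<le> energy k" for k
  proof -
    have "0 \<le> 2 * c * ip I (two_step k) (two_step k)"
      using c_pos by (simp add: ip_self_nonneg)
    with drop[of k] show ?thesis by linarith
  qed
  hence "decseq energy" by (rule decseq_SucI)
  then obtain l where "energy \<longlonglongrightarrow> l"
    using decseq_convergent[of energy 0] energy_nonneg by blast
  hence "(\<lambda>k. (energy k - energy (Suc k)) / (2 * c)) \<longlonglongrightarrow> (l - l) / (2 * c)"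
    using c_pos by (intro tendsto_intros LIMSEQ_Suc) auto
  hence lim: "(\<lambda>k. (energy k - energy (Suc k)) / (2 * c)) \<longlonglongrightarrow> 0" by simp
  have "(\<lambda>k. ip I (two_step k) (two_step k)) \<longlonglongrightarrow> 0"
    by (rule tendsto_sandwich[OF _ _ tendsto_const lim])
      (use drop c_pos in \<open>auto intro!: always_eventually simp: ip_self_nonneg field_simps\<close>)
  thus "i \<in> I \<Longrightarrow> (\<lambda>k. two_step k i) \<longlonglongrightarrow> 0"
    by (simp add: tendsto_ip_self_0_iff[OF finite_I])
qed

text \<open>
  The difference \<open>e\<^sub>k - e\<^sub>k\<^sub>+\<^sub>1\<close> no longer contains the residual, apart from its change \<open>A d\<^sub>k\<close>. This
  determines \<open>d\<^sub>k\<close> by quantities that tend to \<open>0\<close>, through the same operator whose coercivity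
  makes the energy nonnegative.
\<close>

lemma mass_D_eq:
  "(4 - 2*\<omega>) *\<^sub>R D k i + ((\<omega> - 2*\<gamma>) * \<upsilon>) *\<^sub>R adj (app (D k)) i =
   two_step k i - two_step (Suc k) i + (2 - \<omega>) *\<^sub>R two_step k i
     - (\<upsilon> * \<gamma>) *\<^sub>R adj (app (two_step k)) i"
proof -
  define d d' d'' where "d = D k i" and "d' = D (Suc k) i" and "d'' = D (Suc (Suc k)) i"
  define r p q where "r = adj (resid k) i" and "p = adj (app (D k)) i" and "q = adj (app (D (Suc k))) i"
  have d': "d' = (1 - \<omega>) *\<^sub>R d - \<upsilon> *\<^sub>R (\<omega> *\<^sub>R r + \<gamma> *\<^sub>R p)"
    unfolding d'_def d_def r_def p_def by (subst D_Suc) (rule refl)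
  have d'': "d'' = (1 - \<omega>) *\<^sub>R d' - \<upsilon> *\<^sub>R (\<omega> *\<^sub>R (r + p) + \<gamma> *\<^sub>R q)"
    unfolding d'_def d''_def r_def p_def q_def
    by (subst D_Suc) (simp only: resid_Suc adj_add)
  have e: "two_step k i = d + d'" "two_step (Suc k) i = d' + d''"
    by (simp_all add: two_step_def d_def d'_def d''_def)
  have "two_step k = (\<lambda>i. D k i + D (Suc k) i)" by (auto simp: two_step_def)
  hence Ae: "adj (app (two_step k)) i = p + q"
    by (simp add: app_add adj_add p_def q_def)
  have three_d: "3 *\<^sub>R d = d + (d + d)"
    using scaleR_add_left[of 1 2 d] by (simp add: scaleR_2)
  have "d + d' - (d' + d'') + (2 - \<omega>) *\<^sub>R (d + d') - (\<upsilon> * \<gamma>) *\<^sub>R (p + q)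
      = (3 - \<omega>) *\<^sub>R d + d' + (\<upsilon> * \<omega>) *\<^sub>R (r + p) - (\<upsilon> * \<gamma>) *\<^sub>R p"
    unfolding d'' by (simp add: algebra_simps three_d scaleR_2)
  also have "\<dots> = ((3 - \<omega>) + (1 - \<omega>)) *\<^sub>R d + (\<upsilon> * \<omega> - \<upsilon> * \<gamma> - \<upsilon> * \<gamma>) *\<^sub>R p"
    unfolding d' by (simp only: scaleR_add_left scaleR_diff_left scaleR_add_right
        scaleR_diff_right scaleR_scaleR) simp
  also have "(3 - \<omega>) + (1 - \<omega>) = 4 - 2*\<omega>" by simp
  also have "\<upsilon> * \<omega> - \<upsilon> * \<gamma> - \<upsilon> * \<gamma> = (\<omega> - 2*\<gamma>) * \<upsilon>" by (simp add: algebra_simps)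
  finally show ?thesis
    unfolding e Ae d_def p_def by simp
qed

lemma D_tendsto_0:
  assumes "i \<in> I"
  shows "(\<lambda>k. D k i) \<longlonglongrightarrow> 0"
proof -
  define w where "w k = (\<lambda>i. (4 - 2*\<omega>) *\<^sub>R D k i + ((\<omega> - 2*\<gamma>) * \<upsilon>) *\<^sub>R adj (app (D k)) i)" for k
  have "(\<lambda>k. w k i) \<longlonglongrightarrow> 0 - 0 + (2 - \<omega>) *\<^sub>R 0 - (\<upsilon> * \<gamma>) *\<^sub>R adj (app (\<lambda>i. 0)) i" if "i \<in> I" for i
    unfolding w_def mass_D_eq
    by (intro tendsto_diff tendsto_add tendsto_scaleR tendsto_const tendsto_adj tendsto_app
        LIMSEQ_Suc[of "\<lambda>k. two_step k i"] two_step_tendsto_0 that)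
  hence w0: "(\<lambda>k. ip I (w k) (w k)) \<longlonglongrightarrow> 0"
    by (subst tendsto_ip_self_0_iff[OF finite_I]) (simp add: adj_def app_def)
  have le: "ip I (D k) (D k) \<le> ip I (w k) (w k) / c\<^sup>2" for k
  proof -
    have "c * ip I (D k) (D k) \<le> ip I (D k) (w k)"
      using coercive_mass[of "D k"] by (simp add: w_def ip_bilinear ip_adj)
    \<comment> \<open>the scaling by \<open>c\<close> lets the left-hand side absorb the term in \<open>D k\<close>\<close>
    also have "2 * ip I (D k) (w k) \<le> c * ip I (D k) (D k) + ip I (w k) (w k) / c"
      using c_pos by (rule two_ip_le)
    finally have "c * ip I (D k) (D k) \<le> ip I (w k) (w k) / c" by simp
    thus ?thesis using c_pos by (simp add: field_simps power2_eq_square)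
  qed
  have lim: "(\<lambda>k. ip I (w k) (w k) / c\<^sup>2) \<longlonglongrightarrow> 0"
    using tendsto_divide[OF w0 tendsto_const[of "c\<^sup>2"]] c_pos by simp
  have "(\<lambda>k. ip I (D k) (D k)) \<longlonglongrightarrow> 0"
    by (rule tendsto_sandwich[OF _ _ tendsto_const lim])
      (auto intro!: always_eventually ip_self_nonneg le)
  thus ?thesis using assms by (simp add: tendsto_ip_self_0_iff[OF finite_I])
qed

lemma gradient_tendsto_0:
  assumes "i \<in> I"
  shows "(\<lambda>k. adj (resid k) i) \<longlonglongrightarrow> 0"
proof -
  have eq: "adj (resid k) i = (1 / (\<upsilon> * \<omega>)) *\<^sub>R ((2 - \<omega>) *\<^sub>R D k i - two_step k i
      - (\<upsilon> * \<gamma>) *\<^sub>R adj (app (D k)) i)" for k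
  proof -
    have "D (Suc k) i = (1 - \<omega>) *\<^sub>R D k i
        - \<upsilon> *\<^sub>R (\<omega> *\<^sub>R adj (resid k) i + \<gamma> *\<^sub>R adj (app (D k)) i)"
      by (subst D_Suc) (rule refl)
    hence "(2 - \<omega>) *\<^sub>R D k i - two_step k i - (\<upsilon> * \<gamma>) *\<^sub>R adj (app (D k)) i
        = (\<upsilon> * \<omega>) *\<^sub>R adj (resid k) i"
      by (simp add: two_step_def algebra_simps scaleR_2)
    thus ?thesis using weights_pos by simp
  qed
  have "(\<lambda>k. adj (resid k) i) \<longlonglongrightarrow> (1 / (\<upsilon> * \<omega>)) *\<^sub>R ((2 - \<omega>) *\<^sub>R 0 - 0
      - (\<upsilon> * \<gamma>) *\<^sub>R adj (app (\<lambda>i. 0)) i)"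
    unfolding eq
    by (intro tendsto_diff tendsto_scaleR tendsto_const tendsto_adj tendsto_app
        two_step_tendsto_0 D_tendsto_0 assms)
  thus ?thesis by (simp add: adj_def app_def)
qed

lemma ker_orth_D: "ker_orth (D k)"
proof (induction k)
  case 0
  show ?case by (rule orth_D0)
next
  case (Suc k)
  show ?case
    unfolding step_D by (intro ker_orth_diff ker_orth_scaleR Suc ker_orth_adj)
qed

lemma ker_orth_P_diff: "ker_orth (\<lambda>i. P k i - P l i)"
proof -
  have from_0: "ker_orth (\<lambda>i. P k i - P 0 i)" for k
  proof (induction k)
    case 0
    show ?case by (simp add: ker_orth_def)
  next
    case (Suc k)
    from ker_orth_add[OF Suc ker_orth_D[of k]] show ?case
      by (simp add: step_P algebra_simps)
  qed
  from ker_orth_diff[OF from_0[of k] from_0[of l]] show ?thesis by simp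
qed

text \<open>
  Differences of iterates are orthogonal to the kernel, where they are controlled by differences
  of the gradients \<open>A\<^sup>T R\<^sub>k\<close>, which tend to \<open>0\<close>.
\<close>

lemma convergent_P:
  assumes i: "i \<in> I"
  shows "convergent (\<lambda>k. P k i)"
proof -
  obtain b where b: "b > 0" and coercive: "\<And>x::'i \<Rightarrow> 'a. ker_orth x \<Longrightarrow>
      b * ip I x x \<le> ip I (adj (app x)) (adj (app x))"
    using coercive_on_ker_orth by blast
  define g h where "g k = adj (resid k)" and "h k = 2 * ip I (g k) (g k) / b" for k
  have le: "(dist (P k i) (P l i))\<^sup>2 \<le> h k + h l" for k l
  proof -
    have "adj (app (\<lambda>i. P k i - P l i)) = (\<lambda>i. g k i - g l i)"
      by (simp add: g_def app_diff resid_def[abs_def] flip: adj_diff)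
    hence "b * ip I (\<lambda>i. P k i - P l i) (\<lambda>i. P k i - P l i)
        \<le> ip I (\<lambda>i. g k i - g l i) (\<lambda>i. g k i - g l i)"
      using coercive[OF ker_orth_P_diff] by metis
    also have "\<dots> \<le> 2 * ip I (g k) (g k) + 2 * ip I (g l) (g l)"
      using ip_self_nonneg[of I "\<lambda>i. g k i + g l i"]
      by (simp add: ip_bilinear ip_commute[of I "g l" "g k"])
    finally have "ip I (\<lambda>i. P k i - P l i) (\<lambda>i. P k i - P l i) \<le> h k + h l"
      using b by (simp add: h_def field_simps)
    with norm_le_ip_self[OF finite_I i, of "\<lambda>i. P k i - P l i"] show ?thesis
      by (simp add: dist_norm)
  qed
  have "(\<lambda>k. ip I (g k) (g k)) \<longlonglongrightarrow> 0"
    by (simp add: tendsto_ip_self_0_iff[OF finite_I] g_def gradient_tendsto_0)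
  from tendsto_mult_left[OF this, of "2 / b"] have h0: "h \<longlonglongrightarrow> 0"
    by (simp add: h_def[abs_def])
  have "Cauchy (\<lambda>k. P k i)"
  proof (rule metric_CauchyI)
    fix \<epsilon> :: real assume \<epsilon>: "\<epsilon> > 0"
    hence "\<epsilon>\<^sup>2 / 2 > 0" by simp
    from order_tendstoD(2)[OF h0 this] obtain N where N: "\<And>k. k \<ge> N \<Longrightarrow> h k < \<epsilon>\<^sup>2 / 2"
      by (auto simp: eventually_sequentially)
    have "dist (P k i) (P l i) < \<epsilon>" if "k \<ge> N" "l \<ge> N" for k l
    proof (rule power2_less_imp_less)
      show "(dist (P k i) (P l i))\<^sup>2 < \<epsilon>\<^sup>2"
        using le[of k l] N[OF that(1)] N[OF that(2)] by linarith
    qed (use \<epsilon> in simp)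
    thus "\<exists>N. \<forall>k\<ge>N. \<forall>l\<ge>N. dist (P k i) (P l i) < \<epsilon>" by blast
  qed
  thus ?thesis by (rule Cauchy_convergent)
qed

theorem converges_to_normal_equation_solution:
  "\<exists>X. (\<forall>i\<in>I. (\<lambda>k. P k i) \<longlonglongrightarrow> X i) \<and> (\<forall>i\<in>I. adj (\<lambda>j. app X j - Q j) i = 0)"
proof -
  define X where "X i = lim (\<lambda>k. P k i)" for i
  have X: "(\<lambda>k. P k i) \<longlonglongrightarrow> X i" if "i \<in> I" for i
    using convergent_P[OF that] by (simp add: X_def convergent_LIMSEQ_iff)
  have "adj (\<lambda>j. app X j - Q j) i = 0" if "i \<in> I" for i
  proof (rule LIMSEQ_unique[OF _ gradient_tendsto_0[OF that]])
    show "(\<lambda>k. adj (resid k) i) \<longlonglongrightarrow> adj (\<lambda>j. app X j - Q j) i"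
      unfolding resid_def by (intro tendsto_adj tendsto_diff tendsto_app tendsto_const X)
  qed
  with X show ?thesis by blast
qed

end

text \<open>
  Pythagoras: the residual of a solution of the normal equations is orthogonal to the range of the
  matrix.
\<close>

lemma (in finite_real_matrix) normal_equation_imp_minimal:
  assumes "\<And>i. i \<in> I \<Longrightarrow> adj (\<lambda>j. app X j - Q j) i = 0"
  shows "ip J (\<lambda>j. Q j - app X j) (\<lambda>j. Q j - app X j)
    \<le> ip J (\<lambda>j. Q j - app Y j) (\<lambda>j. Q j - app Y j)"
proof -
  define R Z where "R = (\<lambda>j. app X j - Q j)" and "Z = (\<lambda>i. X i - Y i)"
  have "ip I Z (adj R) = 0"
    using assms by (simp add: R_def ip_def)
  hence "ip J (app Z) R = 0"
    by (simp add: ip_adj)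
  moreover have "ip J (\<lambda>j. Q j - app X j) (\<lambda>j. Q j - app X j) = ip J R R"
    by (simp add: R_def ip_def inner_diff_left inner_diff_right inner_commute add.commute)
  moreover have "(\<lambda>j. Q j - app Y j) = (\<lambda>j. app Z j - R j)"
    by (auto simp: R_def Z_def app_diff)
  ultimately show ?thesis
    using ip_self_nonneg[of J "app Z"] by (simp add: ip_bilinear ip_commute[of J R "app Z"])
qed

section \<open>The largest singular value\<close>

lemma eigenvalue_imp_singular_value:
  assumes A: "A \<in> carrier_mat m n" and ev: "eigenvalue (transpose_mat A * A) L"
  shows "sqrt L \<in># singular_values A"
proof -
  have AA: "transpose_mat A * A \<in> carrier_mat n n" using A by simp
  have "poly (char_poly (transpose_mat A * A)) L = 0"
    using ev eigenvalue_root_char_poly[OF AA] by simp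
  moreover have "char_poly (transpose_mat A * A) \<noteq> 0"
    using degree_monic_char_poly[OF AA] by auto
  ultimately show ?thesis by (simp add: singular_values_def)
qed

text \<open>
  The sublocale below is instantiated with the index sets \<open>{1..n}\<close> and \<open>{1..m}\<close>; rewriting their
  lower bound to \<open>Suc 0\<close> would make its constants unrecognizable.
\<close>

declare One_nat_def [simp del]

locale collocation =
  fixes m n :: nat and B :: "nat \<Rightarrow> real \<Rightarrow> real" and t :: "nat \<Rightarrow> real"
begin

sublocale finite_real_matrix "{1..n}" "{1..m}" "\<lambda>j i. B i (t j)"
  by standard auto

lemma app_eq_curve: "app X j = curve n B X (t j)"
  by (simp add: app_def curve_def)

lemma least_square_fit_iff:
  "least_square_fit m n B t Q X \<longleftrightarrow>
    (\<forall>Y. ip {1..m} (\<lambda>j. Q j - app X j) (\<lambda>j. Q j - app X j)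
       \<le> ip {1..m} (\<lambda>j. Q j - app Y j) (\<lambda>j. Q j - app Y j))"
  by (simp add: least_square_fit_def ip_def app_eq_curve power2_norm_eq_inner)

lemma eigenvalue_collocation_mat:
  assumes x: "\<And>i. i \<in> {1..n} \<Longrightarrow> adj (app x) i = L * x i"
    and nonzero: "ip {1..n} x x \<noteq> (0::real)"
  shows "eigenvalue (transpose_mat (collocation_mat m n B t) * collocation_mat m n B t) L"
proof -
  let ?A = "collocation_mat m n B t"
  have A: "?A \<in> carrier_mat m n" by (simp add: collocation_mat_def)
  define v where "v = vec n (\<lambda>i. x (Suc i))"
  have v: "v \<in> carrier_vec n" by (simp add: v_def)
  have Av: "?A *\<^sub>v v = vec m (\<lambda>j. app x (Suc j))"
    by (rule eq_vecI)
      (auto simp: collocation_mat_def v_def scalar_prod_def app_def sum.atLeast1_atMost_eq[folded One_nat_def]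
        atLeast0LessThan)
  have "transpose_mat ?A *\<^sub>v (?A *\<^sub>v v) = vec n (\<lambda>i. adj (app x) (Suc i))"
    unfolding Av
    by (rule eq_vecI)
      (auto simp: collocation_mat_def scalar_prod_def adj_def sum.atLeast1_atMost_eq[folded One_nat_def]
        atLeast0LessThan)
  also have "\<dots> = L \<cdot>\<^sub>v v"
    by (rule eq_vecI) (auto simp: v_def x)
  finally have "(transpose_mat ?A * ?A) *\<^sub>v v = L \<cdot>\<^sub>v v"
    using A v by (simp add: assoc_mult_mat_vec[of _ n m])
  moreover have "v \<noteq> 0\<^sub>v n"
  proof
    assume v0: "v = 0\<^sub>v n"
    have "x i = 0" if i: "i \<in> {1..n}" for i
    proof -
      obtain k where k: "i = Suc k" "k < n" using i by (cases i) auto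
      hence "v $ k = x i" by (simp add: v_def)
      thus ?thesis using k by (simp add: v0)
    qed
    hence "ip {1..n} x x = 0" by (simp add: ip_def)
    with nonzero show False by simp
  qed
  ultimately show ?thesis
    using A v by (auto simp: eigenvalue_def eigenvector_def)
qed

text \<open>
  The optimal constant in the bound is the square of the largest singular value, because it is an
  eigenvalue of \<open>A\<^sup>T A\<close>. It holds for families of points by coordinates.
\<close>

lemma rayleigh_bound_singular_value:
  assumes "n > 0"
  obtains L where "L \<ge> 0" "sqrt L \<in># singular_values (collocation_mat m n B t)"
    "\<And>x::nat \<Rightarrow> 'a::euclidean_space. ip {1..m} (app x) (app x) \<le> L * ip {1..n} x x"
proof -
  have "{1..n} \<noteq> {}" using assms by simp
  from ex_max_eigenvalue_real[OF this] obtain L x0 where L: "L \<ge> 0"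
    and x0: "x0 \<in> unit_sphere {1..n}" "\<And>i. i \<in> {1..n} \<Longrightarrow> adj (app x0) i = L * x0 i"
    and bound: "\<And>x::nat \<Rightarrow> real. ip {1..m} (app x) (app x) \<le> L * ip {1..n} x x"
    by blast
  have "eigenvalue (transpose_mat (collocation_mat m n B t) * collocation_mat m n B t) L"
    using x0 by (intro eigenvalue_collocation_mat[of x0]) (auto simp: unit_sphere_def)
  hence "sqrt L \<in># singular_values (collocation_mat m n B t)"
    by (rule eigenvalue_imp_singular_value[of _ m n, rotated]) (simp add: collocation_mat_def)
  with L show ?thesis
    using that rayleigh_bound_euclidean[OF bound] by blast
qed

end

section \<open>Admissible weights and convergence\<close>

lemma affine_pos_between:
  fixes \<alpha> \<beta> s L :: real
  assumes "\<alpha> > 0" "\<alpha> + \<beta> * s > 0" "0 \<le> L" "L \<le> s"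
  shows "\<alpha> + \<beta> * L > 0"
proof (cases "\<beta> \<ge> 0")
  case True
  thus ?thesis using assms by (intro add_pos_nonneg) auto
next
  case False
  hence "\<beta> * s \<le> \<beta> * L" using assms by (intro mult_left_mono_neg) auto
  thus ?thesis using assms by linarith
qed

text \<open>
  For \<open>p = |x|\<^sup>2\<close>, \<open>q = |A x|\<^sup>2\<close>: the form \<open>\<alpha> p + \<beta> q\<close> is bounded below by \<open>p\<close> times the smaller
  of the values of \<open>\<alpha> + \<beta> \<lambda>\<close> at the ends of \<open>[0, L]\<close>, an interval that contains the spectrum.
\<close>

lemma affine_coercive:
  fixes \<alpha> \<beta> p q L :: real
  assumes "p \<ge> 0" "q \<ge> 0" "q \<le> L * p" "c \<le> \<alpha>" "c \<le> \<alpha> + \<beta> * L"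
  shows "c * p \<le> \<alpha> * p + \<beta> * q"
proof (cases "\<beta> \<ge> 0")
  case True
  have "c * p \<le> \<alpha> * p" using assms by (intro mult_right_mono) auto
  moreover have "\<beta> * q \<ge> 0" using True assms by simp
  ultimately show ?thesis by linarith
next
  case False
  have "c * p \<le> (\<alpha> + \<beta> * L) * p" using assms by (intro mult_right_mono) auto
  also have "\<dots> = \<alpha> * p + \<beta> * (L * p)" by (simp add: algebra_simps)
  also have "\<dots> \<le> \<alpha> * p + \<beta> * q"
    using False assms by (intro add_left_mono mult_left_mono_neg) auto
  finally show ?thesis .
qed

text \<open>
  Multiplied by \<open>s\<^sup>2 \<upsilon>\<close> and \<open>2 s\<^sup>2 \<upsilon>\<close>, the two bounds on \<open>\<gamma>\<close> are the two stability conditions at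
  \<open>s\<^sup>2\<close>, and affine functions that are positive at \<open>0\<close> and \<open>s\<^sup>2\<close> are positive between. The
  hypothesis on \<open>s\<close> is restricted to \<open>L > 0\<close> because \<open>s\<close> will be the largest nonzero singular
  value, which is only compared with nonzero ones.
\<close>

lemma weights_admissible:
  fixes \<omega> \<gamma> \<upsilon> s L :: real
  assumes "0 < \<omega>" "\<omega> < 2" "\<upsilon> > 0"
    and lower: "\<omega> - \<omega> / (s\<^sup>2 * \<upsilon>) < \<gamma>"
    and upper: "\<gamma> < \<omega> / 2 - (\<omega> - 2) / (s\<^sup>2 * \<upsilon>)"
    and L: "L \<ge> 0" "L > 0 \<Longrightarrow> sqrt L \<le> s"
  shows "\<omega> + (\<gamma> - \<omega>) * \<upsilon> * L > 0" and "(4 - 2*\<omega>) + (\<omega> - 2*\<gamma>) * \<upsilon> * L > 0"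
proof -
  have "\<omega> + (\<gamma> - \<omega>) * \<upsilon> * L > 0 \<and> (4 - 2*\<omega>) + (\<omega> - 2*\<gamma>) * \<upsilon> * L > 0"
  proof (cases "L = 0")
    case True
    thus ?thesis using assms by simp
  next
    case False
    hence "sqrt L > 0" "sqrt L \<le> s" using L by auto
    hence s: "s > 0" and "(sqrt L)\<^sup>2 \<le> s\<^sup>2"
      by (linarith, intro power_mono) simp_all
    hence Ls: "L \<le> s\<^sup>2" using L by simp
    have pos: "s\<^sup>2 * \<upsilon> > 0" using s assms by simp
    have lower_eq: "(\<omega> - \<omega> / (s\<^sup>2 * \<upsilon>)) * (s\<^sup>2 * \<upsilon>) = \<omega> * (s\<^sup>2 * \<upsilon>) - \<omega>"
      using s assms(3) by (simp add: left_diff_distrib)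
    have upper_eq: "(\<omega> / 2 - (\<omega> - 2) / (s\<^sup>2 * \<upsilon>)) * (s\<^sup>2 * \<upsilon>) = \<omega> / 2 * (s\<^sup>2 * \<upsilon>) - (\<omega> - 2)"
      using s assms(3) by (simp add: left_diff_distrib[of "\<omega> / 2"])
    have at_s: "\<omega> + (\<gamma> - \<omega>) * \<upsilon> * s\<^sup>2 > 0"
      using mult_strict_right_mono[OF lower pos, unfolded lower_eq] by (simp add: algebra_simps)
    have at_s': "(4 - 2*\<omega>) + (\<omega> - 2*\<gamma>) * \<upsilon> * s\<^sup>2 > 0"
      using mult_strict_right_mono[OF upper pos, unfolded upper_eq] by (simp add: algebra_simps)
    have "4 - 2*\<omega> > 0" using assms(2) by simp
    thus ?thesis
      using affine_pos_between[OF assms(1) at_s L(1) Ls] affine_pos_between[OF _ at_s' L(1) Ls]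
      by blast
  qed
  thus "\<omega> + (\<gamma> - \<omega>) * \<upsilon> * L > 0" "(4 - 2*\<omega>) + (\<omega> - 2*\<gamma>) * \<upsilon> * L > 0" by auto
qed

context collocation
begin

lemma mlspia_delta_eq: "mlspia_delta m n B t Q \<upsilon> X i = \<upsilon> *\<^sub>R adj (\<lambda>j. Q j - app X j) i"
  by (simp add: mlspia_delta_def adj_def app_eq_curve)

lemma mlspia_state_step_P:
  "fst (mlspia_state m n B t Q \<omega> \<gamma> \<upsilon> P0 \<Lambda>0 (Suc k)) =
   (\<lambda>i. fst (mlspia_state m n B t Q \<omega> \<gamma> \<upsilon> P0 \<Lambda>0 k) i + snd (mlspia_state m n B t Q \<omega> \<gamma> \<upsilon> P0 \<Lambda>0 k) i)"
  by (simp add: Let_def split: prod.split)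

lemma mlspia_state_step_D:
  assumes "mlspia_state m n B t Q \<omega> \<gamma> \<upsilon> P0 \<Lambda>0 k = (P, D)"
  shows "snd (mlspia_state m n B t Q \<omega> \<gamma> \<upsilon> P0 \<Lambda>0 (Suc k)) = (\<lambda>i. (1 - \<omega>) *\<^sub>R D i
      - \<upsilon> *\<^sub>R adj (\<lambda>j. \<omega> *\<^sub>R (app P j - Q j) + \<gamma> *\<^sub>R app D j) i)"
  unfolding mlspia_state.simps assms Let_def prod.case snd_conv mlspia_delta_eq app_linear adj_linear
  by (simp add: algebra_simps)

lemma mlspia_iteration_mlspia_state:
  fixes Q P0 \<Lambda>0 :: "nat \<Rightarrow> 'a::euclidean_space"
  assumes "\<omega> > 0" "\<omega> < 2" "\<upsilon> > 0"
    and dissipation: "\<omega> + (\<gamma> - \<omega>) * \<upsilon> * L > 0"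
    and mass: "(4 - 2*\<omega>) + (\<omega> - 2*\<gamma>) * \<upsilon> * L > 0"
    and bound: "\<And>x::nat \<Rightarrow> 'a. ip {1..m} (app x) (app x) \<le> L * ip {1..n} x x"
  shows "\<exists>c. mlspia_iteration {1..n} {1..m} (\<lambda>j i. B i (t j)) Q
    (\<lambda>k. fst (mlspia_state m n B t Q \<omega> \<gamma> \<upsilon> P0 \<Lambda>0 k))
    (\<lambda>k. snd (mlspia_state m n B t Q \<omega> \<gamma> \<upsilon> P0 \<Lambda>0 k)) \<omega> \<gamma> \<upsilon> c"
proof
  let ?c = "Min {\<omega>, \<omega> + (\<gamma> - \<omega>) * \<upsilon> * L, 4 - 2*\<omega>, (4 - 2*\<omega>) + (\<omega> - 2*\<gamma>) * \<upsilon> * L}"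
  show "mlspia_iteration {1..n} {1..m} (\<lambda>j i. B i (t j)) Q
    (\<lambda>k. fst (mlspia_state m n B t Q \<omega> \<gamma> \<upsilon> P0 \<Lambda>0 k))
    (\<lambda>k. snd (mlspia_state m n B t Q \<omega> \<gamma> \<upsilon> P0 \<Lambda>0 k)) \<omega> \<gamma> \<upsilon> ?c"
  proof (intro mlspia_iteration.intro finite_real_matrix_axioms mlspia_iteration_axioms.intro
      mlspia_state_step_P mlspia_state_step_D[OF surjective_pairing])
    have "snd (mlspia_state m n B t Q \<omega> \<gamma> \<upsilon> P0 \<Lambda>0 0) = (\<lambda>i. \<upsilon> *\<^sub>R adj \<Lambda>0 i)"
      by (simp add: adj_def)
    thus "ker_orth (snd (mlspia_state m n B t Q \<omega> \<gamma> \<upsilon> P0 \<Lambda>0 0))"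
      by (simp only: ker_orth_scaleR ker_orth_adj)
    show "0 < ?c" using assms by simp
    fix x :: "nat \<Rightarrow> 'a"
    have "?c * ip {1..n} x x
        \<le> \<omega> * ip {1..n} x x + ((\<gamma> - \<omega>) * \<upsilon>) * ip {1..m} (app x) (app x)"
      by (rule affine_coercive[OF ip_self_nonneg ip_self_nonneg bound]) (auto intro: Min_le)
    thus "?c * ip {1..n} x x
        \<le> \<omega> * ip {1..n} x x - (\<omega> - \<gamma>) * \<upsilon> * ip {1..m} (app x) (app x)"
      by (simp add: left_diff_distrib)
    show "?c * ip {1..n} x x
        \<le> (4 - 2*\<omega>) * ip {1..n} x x + (\<omega> - 2*\<gamma>) * \<upsilon> * ip {1..m} (app x) (app x)"
      by (rule affine_coercive[OF ip_self_nonneg ip_self_nonneg bound]) (auto intro: Min_le)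
  qed (use assms in auto)
qed

end

theorem theorem2:
  fixes m n r :: nat
    and B :: "nat \<Rightarrow> real \<Rightarrow> real"
    and t \<sigma> :: "nat \<Rightarrow> real"
    and Q P0 \<Lambda>0 :: "nat \<Rightarrow> 'a::euclidean_space"
    and \<omega> \<gamma> \<upsilon> :: real
  assumes "m > n"
    and "NTP_basis n B"
    and "strict_mono_on {1..m} t" and "t 1 = 0" and "t m = 1"
    and "vec_space.rank m (collocation_mat m n B t) = r"
    and "image_mset \<sigma> (mset_set {1..r}) = filter_mset (\<lambda>s. s > 0) (singular_values (collocation_mat m n B t))"
    and "\<And>i j. 1 \<le> i \<Longrightarrow> i \<le> j \<Longrightarrow> j \<le> r \<Longrightarrow> \<sigma> j \<le> \<sigma> i"
    and "0 < \<omega>" and "\<omega> < 2"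
    and "\<omega> - \<omega> / ((\<sigma> 1)\<^sup>2 * \<upsilon>) < \<gamma>"
    and "\<gamma> < \<omega> / 2 - (\<omega> - 2) / ((\<sigma> 1)\<^sup>2 * \<upsilon>)"
    and "\<upsilon> > 0"
  shows "converges_to_least_square_fit m n B t Q (mlspia m n B t Q \<omega> \<gamma> \<upsilon> P0 \<Lambda>0)"
proof -
  interpret collocation m n B t .
  \<comment> \<open>the basis functions sum to \<open>1\<close>, so there is at least one of them\<close>
  have "(\<Sum>i=1..n. B i 0) = 1"
    using assms(2) by (simp add: NTP_basis_def)
  hence "n > 0" by (cases n) auto
  then obtain L where L: "L \<ge> 0" "sqrt L \<in># singular_values (collocation_mat m n B t)"
    and bound: "\<And>x::nat \<Rightarrow> 'a. ip {1..m} (app x) (app x) \<le> L * ip {1..n} x x"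
    using rayleigh_bound_singular_value by metis
  have "sqrt L \<le> \<sigma> 1" if "L > 0"
  proof -
    have "sqrt L \<in># image_mset \<sigma> (mset_set {1..r})"
      using L that unfolding assms(7) by simp
    then obtain j where "1 \<le> j" "j \<le> r" "sqrt L = \<sigma> j" by auto
    thus ?thesis using assms(8)[of 1 j] by simp
  qed
  note weights = weights_admissible[OF assms(9,10,13,11,12) L(1) this]
  from mlspia_iteration_mlspia_state[OF assms(9,10,13) weights bound]
  obtain c where "mlspia_iteration {1..n} {1..m} (\<lambda>j i. B i (t j)) Q
    (\<lambda>k. fst (mlspia_state m n B t Q \<omega> \<gamma> \<upsilon> P0 \<Lambda>0 k))
    (\<lambda>k. snd (mlspia_state m n B t Q \<omega> \<gamma> \<upsilon> P0 \<Lambda>0 k)) \<omega> \<gamma> \<upsilon> c"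
    by blast
  from mlspia_iteration.converges_to_normal_equation_solution[OF this]
  obtain X where lim: "\<And>i. i \<in> {1..n} \<Longrightarrow> (\<lambda>k. mlspia m n B t Q \<omega> \<gamma> \<upsilon> P0 \<Lambda>0 k i) \<longlonglongrightarrow> X i"
    and normal: "\<And>i. i \<in> {1..n} \<Longrightarrow> adj (\<lambda>j. app X j - Q j) i = 0"
    unfolding mlspia_def by blast
  have "least_square_fit m n B t Q X"
    unfolding least_square_fit_iff by (intro allI normal_equation_imp_minimal normal)
  with lim show ?thesis
    unfolding converges_to_least_square_fit_def by blast
qed

end
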